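(* Let $s\ge 1$ be an integer, let $c\in\mathbb{R}^N$, $c\neq 0$, and let $j_0\in\{1,\dots,N\}$ be such that $$|\langle Tc,f'_{j_0}\rangle|=\max_{1\le j\le N}|\langle Tc,f'_j\rangle|,\qquad\text{where } f'_j=\frac{f_j}{\|f_j\|},\ 1\le j\le N .$$ If $c$ is $s$-sparse and $\delta_s+\mu s<1$, then $j_0\in\operatorname{supp}c$.
   Context: $\mathcal{H}$ is a real $n$-dimensional inner product space, and $\mathcal{F}=\{f_1,\dots,f_N\}\subset\mathcal{H}$ ($N\ge 2$) is a finite family of vectors with $w_i:=\|f_i\|\neq 0$ for all $i$. The synthesis operator is $T:\mathbb{R}^N\to\mathcal{H}$, $T(c_1,\dots,c_N)=\sum_{j=1}^N c_jf_j$. The coherence of $\mathcal{F}$ is $\mu:=\max_{i\ne j}\frac{|\langle f_i,f_j\rangle|}{\|f_i\|\,\|f_j\|}$. For $c\in\mathbb{R}^N$: $\|c\|_{2,w}:=\left(\sum_{i=1}^N|c_i|^2w_i^2\right)^{1/2}$; $\operatorname{supp}c=\{i:c_i\ne0\}$; $\|c\|_0=\#\operatorname{supp}c$; $c$ is $s$-sparse if $\|c\|_0\le s$. Further, $\delta_s:=\sup_{c\ne0,\ \|c\|_0\le s}\frac{\left|\|Tc\|^2-\|c\|_{2,w}^2\right|}{\|c\|_{2,w}^2}$ (supremum over $c\in\mathbb{R}^N$). *)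

theory Defs
  imports "HOL-Analysis.Analysis"
begin

definition synthesis :: "('n::finite \<Rightarrow> 'a::real_vector) \<Rightarrow> real ^ 'n \<Rightarrow> 'a" where
  "synthesis f c = (\<Sum>j\<in>UNIV. (c $ j) *\<^sub>R f j)"

(* The maximum is over a nonempty set only if the index type has at least two elements. *)
definition coherence :: "('n::finite \<Rightarrow> 'a::real_inner) \<Rightarrow> real" where
  "coherence f = Max {\<bar>f i \<bullet> f j\<bar> / (norm (f i) * norm (f j)) | i j. i \<noteq> j}"

definition weighted_norm :: "('n::finite \<Rightarrow> real) \<Rightarrow> real ^ 'n \<Rightarrow> real" where
  "weighted_norm w c = sqrt (\<Sum>i\<in>UNIV. \<bar>c $ i\<bar>\<^sup>2 * (w i)\<^sup>2)"

definition supp :: "real ^ 'n::finite \<Rightarrow> 'n set" where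
  "supp c = {i. c $ i \<noteq> 0}"

definition is_sparse :: "nat \<Rightarrow> real ^ 'n::finite \<Rightarrow> bool" where
  "is_sparse s c \<longleftrightarrow> card (supp c) \<le> s"

(* The supremum is taken in the reals.  For nonzero vectors f i and s at least 1 the set is
   nonempty and bounded above (by Cauchy-Schwarz), so that it is the true supremum. *)
definition isometry_const :: "('n::finite \<Rightarrow> 'a::real_normed_vector) \<Rightarrow> nat \<Rightarrow> real" where
  "isometry_const f s =
    Sup {\<bar>(norm (synthesis f c))\<^sup>2 - (weighted_norm (\<lambda>i. norm (f i)) c)\<^sup>2\<bar>
           / (weighted_norm (\<lambda>i. norm (f i)) c)\<^sup>2 | c. c \<noteq> 0 \<and> is_sparse s c}"

definition normalized :: "('n::finite \<Rightarrow> 'a::real_normed_vector) \<Rightarrow> 'n \<Rightarrow> 'a" where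
  "normalized f j = f j /\<^sub>R norm (f j)"

end

theory Submission
  imports Defs
begin

text \<open>
  If \<open>j\<^sub>0\<close> lies outside the support of \<open>c\<close>, then every term of \<open>\<langle>Tc, f'\<^sub>j\<^sub>0\<rangle>\<close> is an off-diagonal
  correlation, so with \<open>A = \<Sum>\<^sub>i |c\<^sub>i| w\<^sub>i\<close> this maximal correlation is at most \<open>\<mu> A\<close>. Expanding
  \<open>\<parallel>Tc\<parallel>\<^sup>2\<close> in its second argument gives \<open>\<parallel>Tc\<parallel>\<^sup>2 \<le> A \<cdot> \<mu> A\<close>, which is at most \<open>\<mu> s \<parallel>c\<parallel>\<^sup>2\<close>
  (weighted norm) by Cauchy--Schwarz on the support. But \<open>\<parallel>Tc\<parallel>\<^sup>2 \<ge> (1 - \<delta>\<^sub>s) \<parallel>c\<parallel>\<^sup>2\<close>, so that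
  \<open>1 \<le> \<delta>\<^sub>s + \<mu> s\<close>.
\<close>

lemma weighted_norm_squared:
  "(weighted_norm w c)\<^sup>2 = (\<Sum>i\<in>UNIV. (\<bar>c $ i\<bar> * w i)\<^sup>2)"
  by (simp add: weighted_norm_def sum_nonneg power_mult_distrib)

lemma weighted_norm_squared_pos:
  assumes "c \<noteq> 0" and "\<And>i. w i \<noteq> 0"
  shows "(weighted_norm w c)\<^sup>2 > 0"
proof -
  obtain i where "c $ i \<noteq> 0"
    using assms(1) by (auto simp: vec_eq_iff)
  then have "(\<bar>c $ i\<bar> * w i)\<^sup>2 > 0"
    using assms(2) by simp
  then show ?thesis
    unfolding weighted_norm_squared by (intro sum_pos2[of _ i]) auto
qed

text \<open>Cauchy-Schwarz against the indicator of \<open>supp c\<close>: dropping the zero terms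
  first makes the factor the size of the support rather than the full dimension.\<close>

lemma weighted_l1_squared_le:
  "(\<Sum>i\<in>UNIV. \<bar>c $ i\<bar> * w i)\<^sup>2 \<le> real (card (supp c)) * (weighted_norm w c)\<^sup>2"
proof -
  have l1: "(\<Sum>i\<in>UNIV. \<bar>c $ i\<bar> * w i) = (\<Sum>i\<in>supp c. \<bar>c $ i\<bar> * w i)"
    by (rule sum.mono_neutral_right) (auto simp: supp_def)
  have l2: "(\<Sum>i\<in>UNIV. (\<bar>c $ i\<bar> * w i)\<^sup>2) = (\<Sum>i\<in>supp c. (\<bar>c $ i\<bar> * w i)\<^sup>2)"
    by (rule sum.mono_neutral_right) (auto simp: supp_def)
  show ?thesis
    unfolding weighted_norm_squared l1 l2
    using sum_squared_le_sum_of_squares[of "\<lambda>i. \<bar>c $ i\<bar> * w i" "supp c"]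
    by (simp add: mult.commute)
qed

lemma norm_synthesis_le:
  fixes f :: "'n::finite \<Rightarrow> 'a::real_normed_vector"
  shows "norm (synthesis f c) \<le> (\<Sum>i\<in>UNIV. \<bar>c $ i\<bar> * norm (f i))"
  unfolding synthesis_def by (rule order_trans[OF norm_sum]) simp

text \<open>For a real \<open>Sup\<close> to dominate the members of its set, the set has to be
  bounded above. The triangle inequality and \<open>weighted_l1_squared_le\<close> bound all the
  quotients uniformly.\<close>

lemma isometry_const_bound:
  fixes f :: "'n::finite \<Rightarrow> 'a::real_normed_vector"
  assumes nz: "\<And>i. norm (f i) \<noteq> 0" and "c \<noteq> 0" and "is_sparse s c"
  shows "\<bar>(norm (synthesis f c))\<^sup>2 - (weighted_norm (\<lambda>i. norm (f i)) c)\<^sup>2\<bar>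
    \<le> isometry_const f s * (weighted_norm (\<lambda>i. norm (f i)) c)\<^sup>2"
proof -
  define W where "W = (\<lambda>d. (weighted_norm (\<lambda>i. norm (f i)) d)\<^sup>2)"
  define Q where "Q = (\<lambda>d. \<bar>(norm (synthesis f d))\<^sup>2 - W d\<bar> / W d)"
  have Wpos: "W d > 0" if "d \<noteq> 0" for d
    unfolding W_def using that nz by (rule weighted_norm_squared_pos)
  have "Q d \<le> real s + 1" if "d \<noteq> 0" "is_sparse s d" for d
  proof -
    have "(norm (synthesis f d))\<^sup>2 \<le> (\<Sum>i\<in>UNIV. \<bar>d $ i\<bar> * norm (f i))\<^sup>2"
      by (intro power_mono norm_synthesis_le) simp
    also have "\<dots> \<le> real (card (supp d)) * W d"
      unfolding W_def by (rule weighted_l1_squared_le)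
    also have "\<dots> \<le> real s * W d"
      using that Wpos[of d] by (simp add: is_sparse_def)
    \<comment> \<open>The difference lies between \<open>- W d\<close> and
      \<open>(real s - 1) * W d\<close>; the constant \<open>real s + 1\<close> covers both
      signs.\<close>
    finally have "\<bar>(norm (synthesis f d))\<^sup>2 - W d\<bar> \<le> (real s + 1) * W d"
      using Wpos[OF that(1)] zero_le_power2[of "norm (synthesis f d)"]
        mult_nonneg_nonneg[of "real s" "W d"]
      by (simp add: algebra_simps abs_le_iff)
    then show ?thesis
      using Wpos[OF that(1)] by (simp add: Q_def pos_divide_le_eq)
  qed
  then have "bdd_above {Q d | d. d \<noteq> 0 \<and> is_sparse s d}"
    by (intro bdd_aboveI) auto
  then have "Q c \<le> isometry_const f s"
    unfolding isometry_const_def W_def[symmetric] Q_def[symmetric]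
    using assms by (intro cSup_upper) (auto simp: Q_def W_def)
  then show ?thesis
    using Wpos[OF assms(2)] by (simp add: Q_def W_def pos_divide_le_eq)
qed

lemma coherence_bound:
  fixes f :: "'n::finite \<Rightarrow> 'a::real_inner"
  assumes "\<And>i. norm (f i) \<noteq> 0" and "i \<noteq> j"
  shows "\<bar>f i \<bullet> f j\<bar> \<le> coherence f * (norm (f i) * norm (f j))"
proof -
  have "finite {\<bar>f i \<bullet> f j\<bar> / (norm (f i) * norm (f j)) | i j. i \<noteq> j}"
    by (rule finite_subset[of _
          "range (\<lambda>(i, j). \<bar>f i \<bullet> f j\<bar> / (norm (f i) * norm (f j)))"]) auto
  then have "\<bar>f i \<bullet> f j\<bar> / (norm (f i) * norm (f j)) \<le> coherence f"
    unfolding coherence_def using assms(2) by (intro Max_ge) blast+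
  moreover have "norm (f i) * norm (f j) > 0"
    using assms(1) by simp
  ultimately show ?thesis
    by (simp only: pos_divide_le_eq)
qed

text \<open>\<open>Max\<close> of an empty set is unspecified, so the sign is read off from an
  actual pair of distinct indices.\<close>

lemma coherence_nonneg:
  fixes f :: "'n::finite \<Rightarrow> 'a::real_inner"
  assumes "\<And>i. norm (f i) \<noteq> 0" and "CARD('n) \<ge> 2"
  shows "coherence f \<ge> 0"
proof -
  obtain i j :: 'n where "i \<noteq> j"
    using assms(2) card_le_Suc0_iff_eq[of "UNIV :: 'n set"] by fastforce
  then have "\<bar>f i \<bullet> f j\<bar> \<le> coherence f * (norm (f i) * norm (f j))"
    by (intro coherence_bound assms(1))
  then have "0 \<le> coherence f * (norm (f i) * norm (f j))"
    by (rule order_trans[OF abs_ge_zero])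
  moreover have "norm (f i) * norm (f j) > 0"
    using assms(1) by simp
  ultimately show ?thesis
    by (simp only: zero_le_mult_iff) linarith
qed

text \<open>Coherence controls only pairs of distinct vectors. The diagonal term
  \<open>i = j\<close> vanishes because its coefficient \<open>c $ j\<close> is zero off the
  support.\<close>

lemma inner_normalized_off_support_le:
  fixes f :: "'n::finite \<Rightarrow> 'a::real_inner"
  assumes nz: "\<And>i. norm (f i) \<noteq> 0" and "j \<notin> supp c"
  shows "\<bar>synthesis f c \<bullet> normalized f j\<bar>
    \<le> coherence f * (\<Sum>i\<in>UNIV. \<bar>c $ i\<bar> * norm (f i))"
proof -
  have "\<bar>synthesis f c \<bullet> f j\<bar> \<le> (\<Sum>i\<in>UNIV. \<bar>c $ i\<bar> * \<bar>f i \<bullet> f j\<bar>)"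
    unfolding synthesis_def inner_sum_left
    by (rule order_trans[OF sum_abs]) (simp add: abs_mult)
  also have "\<dots> \<le> (\<Sum>i\<in>UNIV. \<bar>c $ i\<bar> * (coherence f * (norm (f i) * norm (f j))))"
  proof (rule sum_mono)
    fix i
    show "\<bar>c $ i\<bar> * \<bar>f i \<bullet> f j\<bar> \<le> \<bar>c $ i\<bar> * (coherence f * (norm (f i) * norm (f j)))"
    proof (cases "i = j")
      case True
      then show ?thesis using assms(2) by (simp add: supp_def)
    next
      case False
      then show ?thesis by (intro mult_left_mono coherence_bound nz) simp_all
    qed
  qed
  also have "\<dots> = coherence f * (\<Sum>i\<in>UNIV. \<bar>c $ i\<bar> * norm (f i)) * norm (f j)"
    by (simp add: sum_distrib_left sum_distrib_right mult_ac)
  finally have "\<bar>synthesis f c \<bullet> f j\<bar> / norm (f j)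
      \<le> coherence f * (\<Sum>i\<in>UNIV. \<bar>c $ i\<bar> * norm (f i))"
    using nz[of j] by (simp add: pos_divide_le_eq)
  then show ?thesis
    by (simp add: normalized_def abs_mult divide_inverse mult.commute)
qed

text \<open>Expanding just one factor of the inner product of \<open>synthesis f c\<close> with
  itself leaves the correlations that \<open>M\<close> bounds.\<close>

lemma norm_synthesis_squared_le:
  fixes f :: "'n::finite \<Rightarrow> 'a::real_inner"
  assumes nz: "\<And>i. norm (f i) \<noteq> 0"
    and M: "\<And>j. \<bar>synthesis f c \<bullet> normalized f j\<bar> \<le> M"
  shows "(norm (synthesis f c))\<^sup>2 \<le> (\<Sum>i\<in>UNIV. \<bar>c $ i\<bar> * norm (f i)) * M"
proof -
  have "(norm (synthesis f c))\<^sup>2 = synthesis f c \<bullet> (\<Sum>i\<in>UNIV. (c $ i) *\<^sub>R f i)"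
    by (simp add: power2_norm_eq_inner synthesis_def)
  also have "\<dots> = (\<Sum>i\<in>UNIV. c $ i * (synthesis f c \<bullet> f i))"
    by (simp add: inner_sum_right)
  also have "\<dots> \<le> (\<Sum>i\<in>UNIV. (\<bar>c $ i\<bar> * norm (f i)) * M)"
  proof (rule sum_mono)
    fix i
    have "synthesis f c \<bullet> f i = norm (f i) * (synthesis f c \<bullet> normalized f i)"
      using nz[of i] by (simp add: normalized_def)
    then have "c $ i * (synthesis f c \<bullet> f i)
        \<le> (\<bar>c $ i\<bar> * norm (f i)) * \<bar>synthesis f c \<bullet> normalized f i\<bar>"
      using abs_ge_self[of "c $ i * (synthesis f c \<bullet> f i)"] by (simp add: abs_mult mult.assoc)
    also have "\<dots> \<le> (\<bar>c $ i\<bar> * norm (f i)) * M"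
      by (intro mult_left_mono M) simp
    finally show "c $ i * (synthesis f c \<bullet> f i) \<le> (\<bar>c $ i\<bar> * norm (f i)) * M" .
  qed
  finally show ?thesis
    by (simp add: sum_distrib_right)
qed

theorem theorem5:
  fixes f :: "'n::finite \<Rightarrow> 'a::euclidean_space"
    and c :: "real ^ 'n"
    and s :: nat
    and j0 :: 'n
  assumes "CARD('n) \<ge> 2"
    and "\<And>i. norm (f i) \<noteq> 0"
    and "s \<ge> 1"
    and "c \<noteq> 0"
    and "\<bar>synthesis f c \<bullet> normalized f j0\<bar>
           = Max (range (\<lambda>j. \<bar>synthesis f c \<bullet> normalized f j\<bar>))"
    and "is_sparse s c"
    and "isometry_const f s + coherence f * real s < 1"
  shows "j0 \<in> supp c"
proof (rule ccontr)
  assume "j0 \<notin> supp c"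
  define A where "A = (\<Sum>i\<in>UNIV. \<bar>c $ i\<bar> * norm (f i))"
  define W where "W = (weighted_norm (\<lambda>i. norm (f i)) c)\<^sup>2"
  have Wpos: "W > 0"
    unfolding W_def using assms(4,2) by (rule weighted_norm_squared_pos)
  \<comment> \<open>Maximality at \<open>j0\<close> passes the off-support bound on to every index,
    including those in the support.\<close>
  have "\<bar>synthesis f c \<bullet> normalized f j\<bar> \<le> coherence f * A" for j
  proof -
    have "\<bar>synthesis f c \<bullet> normalized f j\<bar> \<le> \<bar>synthesis f c \<bullet> normalized f j0\<bar>"
      unfolding assms(5) by (rule Max_ge) auto
    also have "\<dots> \<le> coherence f * A"
      unfolding A_def using assms(2) \<open>j0 \<notin> supp c\<close> by (rule inner_normalized_off_support_le)
    finally show ?thesis .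
  qed
  then have "(norm (synthesis f c))\<^sup>2 \<le> A * (coherence f * A)"
    unfolding A_def by (intro norm_synthesis_squared_le assms(2))
  also have "\<dots> = coherence f * A\<^sup>2"
    by (simp add: power2_eq_square)
  \<comment> \<open>This is substituted under the factor \<open>coherence f\<close>; the
    monotonicity required is discharged at the end of the chain by
    \<open>coherence_nonneg\<close>.\<close>
  also have "A\<^sup>2 \<le> real (card (supp c)) * W"
    unfolding A_def W_def by (rule weighted_l1_squared_le)
  also have "\<dots> \<le> real s * W"
    using assms(6) Wpos by (simp add: is_sparse_def)
  finally have upper: "(norm (synthesis f c))\<^sup>2 \<le> coherence f * (real s * W)"
    using coherence_nonneg[of f] assms(1,2) by (simp add: mult_left_mono)
  have "W - (norm (synthesis f c))\<^sup>2 \<le> isometry_const f s * W"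
    using isometry_const_bound[of f c s] assms(2,4,6) by (simp add: W_def abs_le_iff)
  \<comment> \<open>Adding the upper and lower estimates eliminates the norm of
    \<open>synthesis f c\<close>. The factor \<open>1\<close> is written out so that
    \<open>W\<close> can be cancelled as a common right factor.\<close>
  with upper have "1 * W \<le> (isometry_const f s + coherence f * real s) * W"
    by (simp add: algebra_simps)
  then show False
    using assms(7) Wpos by (simp only: mult_le_cancel_right_pos)
qed

end
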